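(* Let $X$ be a $1$-skeletal simplicial set with finitely many non-degenerate simplices. A simplicial distribution $p:X\to D(\Delta_{\mathbb{Z}_2})$ is strongly contextual if and only if there exists a circle $C\subset X$ such that $p|_{C}$ is a PR box.
   Context: For a set $S$, $D(S)$ is the set of finitely supported functions $p:S\to\mathbb{R}_{\ge 0}$ with $\sum_{s}p(s)=1$; for $f:S\to S'$, $D(f)(p)(s')=\sum_{s\in f^{-1}(s')}p(s)$. For a simplicial set $Y$, $D(Y)$ is the simplicial set with $D(Y)_n=D(Y_n)$ and structure maps $D(d_i),D(s_j)$. A simplicial distribution on $(X,Y)$ is a simplicial set map $p:X\to D(Y)$; $p_\sigma$ denotes its value at a simplex $\sigma$. The support $\mathrm{supp}(p)$ is the set of simplicial set maps $\varphi:X\to Y$ with $p_n(x)(\varphi_n(x))\neq 0$ for all $n$ and $x\in X_n$; $p$ is strongly contextual if $\mathrm{supp}(p)=\emptyset$. For a set $U$, $\Delta_U$ is the simplicial set with $(\Delta_U)_n=U^{n+1}$, $d_i$ deleting the $i$-th entry and $s_j$ repeating the $j$-th entry. A distribution $p_\sigma\in D(\mathbb{Z}_2\times\mathbb{Z}_2)$ on a $1$-simplex is written as the $2\times 2$ matrix with $(a,b)$-entry $p_\sigma(a,b)$, $a,b\in\{0,1\}$. A circle is a $1$-skeletal simplicial set $C$ with pairwise distinct non-degenerate $1$-simplices $\sigma_1,\dots,\sigma_n$ ($n\ge 1$) and exactly $n$ distinct $0$-simplices $v_1,\dots,v_n$ such that for some $i_k\in\{0,1\}$ and $i'_k=1-i_k$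 one has $d_{i_k}(\sigma_k)=v_k$ and $d_{i'_k}(\sigma_k)=v_{k+1}$ for all $k$, with $v_{n+1}=v_1$. A PR (Popescu–Rohrlich) box on a circle $C$ is a simplicial distribution $q:C\to D(\Delta_{\mathbb{Z}_2})$ such that each $q_{\sigma_k}$ is either $\begin{pmatrix}1/2&0\\0&1/2\end{pmatrix}$ or $\begin{pmatrix}0&1/2\\1/2&0\end{pmatrix}$, and the number of $k$ for which the second matrix occurs is odd. *)

theory Defs
  imports "HOL-Probability.Probability_Mass_Function" "HOL-Library.Z2"
begin

section \<open>Simplicial sets\<close>

text \<open>
  The dimension argument of \<open>face\<close> and \<open>degen\<close> is the dimension of the source:
  \<open>face X n i\<close> is the map $d_i : X_n \to X_{n-1}$ (for $n \ge 1$) and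
  \<open>degen X n j\<close> is $s_j : X_n \to X_{n+1}$. Values outside \<open>simp X n\<close> are irrelevant.
  The sets \<open>simp X n\<close> for different \<open>n\<close> need not be disjoint, so a simplex is
  always given together with its dimension.
\<close>

record 'a sset =
  simp :: "nat \<Rightarrow> 'a set"
  face :: "nat \<Rightarrow> nat \<Rightarrow> 'a \<Rightarrow> 'a"
  degen :: "nat \<Rightarrow> nat \<Rightarrow> 'a \<Rightarrow> 'a"

definition simplicial_set :: "'a sset \<Rightarrow> bool" where
  "simplicial_set X \<longleftrightarrow>
     (\<forall>n. \<forall>i\<le>Suc n. face X (Suc n) i \<in> simp X (Suc n) \<rightarrow> simp X n) \<and>
     (\<forall>n. \<forall>j\<le>n. degen X n j \<in> simp X n \<rightarrow> simp X (Suc n)) \<and>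
     (\<forall>n. \<forall>x\<in>simp X (n+2). \<forall>i j. i < j \<longrightarrow> j \<le> n+2 \<longrightarrow>
        face X (n+1) i (face X (n+2) j x) = face X (n+1) (j-1) (face X (n+2) i x)) \<and>
     (\<forall>n. \<forall>x\<in>simp X n. \<forall>i j. i \<le> j \<longrightarrow> j \<le> n \<longrightarrow>
        degen X (n+1) i (degen X n j x) = degen X (n+1) (j+1) (degen X n i x)) \<and>
     (\<forall>n. \<forall>x\<in>simp X (n+1). \<forall>i j. i < j \<longrightarrow> j \<le> n+1 \<longrightarrow>
        face X (n+2) i (degen X (n+1) j x) = degen X n (j-1) (face X (n+1) i x)) \<and>
     (\<forall>n. \<forall>x\<in>simp X n. \<forall>j\<le>n.
        face X (n+1) j (degen X n j x) = x \<and> face X (n+1) (j+1) (degen X n j x) = x) \<and>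
     (\<forall>n. \<forall>x\<in>simp X (n+1). \<forall>i j. j + 1 < i \<longrightarrow> i \<le> n+2 \<longrightarrow>
        face X (n+2) i (degen X (n+1) j x) = degen X n j (face X (n+1) (i-1) x))"

definition simplicial_map :: "'a sset \<Rightarrow> 'b sset \<Rightarrow> (nat \<Rightarrow> 'a \<Rightarrow> 'b) \<Rightarrow> bool" where
  "simplicial_map X Y f \<longleftrightarrow>
     (\<forall>n. f n \<in> simp X n \<rightarrow> simp Y n) \<and>
     (\<forall>n. \<forall>x\<in>simp X (Suc n). \<forall>i\<le>Suc n. f n (face X (Suc n) i x) = face Y (Suc n) i (f (Suc n) x)) \<and>
     (\<forall>n. \<forall>x\<in>simp X n. \<forall>j\<le>n. f (Suc n) (degen X n j x) = degen Y n j (f n x))"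

definition simplicial_subset :: "'a sset \<Rightarrow> 'a sset \<Rightarrow> bool" where
  "simplicial_subset C X \<longleftrightarrow>
     simplicial_set C \<and>
     (\<forall>n. simp C n \<subseteq> simp X n) \<and>
     (\<forall>n. \<forall>x\<in>simp C (Suc n). \<forall>i\<le>Suc n. face C (Suc n) i x = face X (Suc n) i x) \<and>
     (\<forall>n. \<forall>x\<in>simp C n. \<forall>j\<le>n. degen C n j x = degen X n j x)"

definition nondegenerate :: "'a sset \<Rightarrow> nat \<Rightarrow> 'a set" where
  "nondegenerate X n =
     {x \<in> simp X n. \<not> (\<exists>m j y. n = Suc m \<and> j \<le> m \<and> y \<in> simp X m \<and> x = degen X m j y)}"

definition skeletal :: "nat \<Rightarrow> 'a sset \<Rightarrow> bool" where
  "skeletal k X \<longleftrightarrow> (\<forall>n>k. nondegenerate X n = {})"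

definition finitely_many_nondegenerate :: "'a sset \<Rightarrow> bool" where
  "finitely_many_nondegenerate X \<longleftrightarrow> finite (SIGMA n:UNIV. nondegenerate X n)"

text \<open>An $n$-simplex $(u_0,\dots,u_n)$ of $\Delta_U$ is a list of length $n+1$.\<close>

definition Delta :: "'u set \<Rightarrow> 'u list sset" where
  "Delta U = \<lparr>
     simp = (\<lambda>n. {xs. length xs = n + 1 \<and> set xs \<subseteq> U}),
     face = (\<lambda>n i xs. take i xs @ drop (i + 1) xs),
     degen = (\<lambda>n j xs. take (j + 1) xs @ drop j xs)\<rparr>"

abbreviation Delta_Z2 :: "bit list sset" where
  "Delta_Z2 \<equiv> Delta (UNIV :: bit set)"

section \<open>Simplicial distributions\<close>

text \<open>
  A finitely supported distribution on the set \<open>S\<close> is a probability mass function whose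
  support is finite and contained in \<open>S\<close>; \<open>pmf p s\<close> is the value $p(s)$.
  On these, \<open>map_pmf f\<close> is $D(f)$, see the lemma below.
\<close>

definition fin_dist :: "'a set \<Rightarrow> 'a pmf set" where
  "fin_dist S = {p. finite (set_pmf p) \<and> set_pmf p \<subseteq> S}"

lemma pmf_map_fin_dist:
  assumes "p \<in> fin_dist S"
  shows "pmf (map_pmf f p) s' = (\<Sum>s | s \<in> S \<and> f s = s' \<and> pmf p s \<noteq> 0. pmf p s)"
proof -
  have fin: "finite (set_pmf p)" and sub: "set_pmf p \<subseteq> S"
    using assms by (auto simp: fin_dist_def)
  have eq: "{s. s \<in> S \<and> f s = s' \<and> pmf p s \<noteq> 0} = f -` {s'} \<inter> set_pmf p"
    using sub by (auto simp: set_pmf_iff)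
  have "pmf (map_pmf f p) s' = measure (measure_pmf p) (f -` {s'} \<inter> set_pmf p)"
    by (simp add: pmf_map measure_Int_set_pmf)
  also have "\<dots> = (\<Sum>s\<in>f -` {s'} \<inter> set_pmf p. pmf p s)"
    using fin by (intro measure_measure_pmf_finite) auto
  finally show ?thesis using eq by simp
qed

definition Dist :: "'b sset \<Rightarrow> 'b pmf sset" where
  "Dist Y = \<lparr>
     simp = (\<lambda>n. fin_dist (simp Y n)),
     face = (\<lambda>n i. map_pmf (face Y n i)),
     degen = (\<lambda>n j. map_pmf (degen Y n j))\<rparr>"

text \<open>
  As functions on \<open>simp X n\<close> are not required to be extensional, the restriction of \<open>p\<close>
  to a simplicial subset \<open>C\<close> of \<open>X\<close> is \<open>p\<close> itself, regarded as a distribution on \<open>(C, Y)\<close>.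
\<close>

definition simplicial_distribution ::
    "'a sset \<Rightarrow> 'b sset \<Rightarrow> (nat \<Rightarrow> 'a \<Rightarrow> 'b pmf) \<Rightarrow> bool" where
  "simplicial_distribution X Y p \<longleftrightarrow> simplicial_map X (Dist Y) p"

definition supp ::
    "'a sset \<Rightarrow> 'b sset \<Rightarrow> (nat \<Rightarrow> 'a \<Rightarrow> 'b pmf) \<Rightarrow> (nat \<Rightarrow> 'a \<Rightarrow> 'b) set" where
  "supp X Y p =
     {\<phi>. simplicial_map X Y \<phi> \<and> (\<forall>n. \<forall>x\<in>simp X n. pmf (p n x) (\<phi> n x) \<noteq> 0)}"

definition strongly_contextual ::
    "'a sset \<Rightarrow> 'b sset \<Rightarrow> (nat \<Rightarrow> 'a \<Rightarrow> 'b pmf) \<Rightarrow> bool" where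
  "strongly_contextual X Y p \<longleftrightarrow> supp X Y p = {}"

section \<open>Circles and PR boxes\<close>

text \<open>
  The edges \<open>\<sigma> 1, \<dots>, \<sigma> n\<close> list all non-degenerate 1-simplices of \<open>C\<close>, and
  \<open>v 1, \<dots>, v n\<close> all its vertices, both without repetition.
  For \<open>n = 1\<close> the circle is a loop.
\<close>

definition circle_data ::
    "'a sset \<Rightarrow> nat \<Rightarrow> (nat \<Rightarrow> 'a) \<Rightarrow> (nat \<Rightarrow> 'a) \<Rightarrow> bool" where
  "circle_data C n \<sigma> v \<longleftrightarrow>
     simplicial_set C \<and> skeletal 1 C \<and> n \<ge> 1 \<and>
     bij_betw \<sigma> {1..n} (nondegenerate C 1) \<and>
     bij_betw v {1..n} (simp C 0) \<and>
     v (n + 1) = v 1 \<and>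
     (\<forall>k\<in>{1..n}. \<exists>i\<in>{0, 1}. face C 1 i (\<sigma> k) = v k \<and> face C 1 (1 - i) (\<sigma> k) = v (k + 1))"

definition circle :: "'a sset \<Rightarrow> bool" where
  "circle C \<longleftrightarrow> (\<exists>n \<sigma> v. circle_data C n \<sigma> v)"

text \<open>The matrix of a distribution on pairs, given by its rows.\<close>

definition edge_matrix :: "bit list pmf \<Rightarrow> (real \<times> real) \<times> (real \<times> real)" where
  "edge_matrix p = ((pmf p [0, 0], pmf p [0, 1]), (pmf p [1, 0], pmf p [1, 1]))"

definition PR_box :: "'a sset \<Rightarrow> (nat \<Rightarrow> 'a \<Rightarrow> bit list pmf) \<Rightarrow> bool" where
  "PR_box C q \<longleftrightarrow>
     simplicial_distribution C Delta_Z2 q \<and>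
     (\<exists>n \<sigma> v. circle_data C n \<sigma> v \<and>
        (\<forall>k\<in>{1..n}. edge_matrix (q 1 (\<sigma> k)) = ((1/2, 0), (0, 1/2)) \<or>
                    edge_matrix (q 1 (\<sigma> k)) = ((0, 1/2), (1/2, 0))) \<and>
        odd (card {k\<in>{1..n}. edge_matrix (q 1 (\<sigma> k)) = ((0, 1/2), (1/2, 0))}))"

section \<open>Well-definedness\<close>

lemma simplicial_set_Delta: "simplicial_set (Delta U)"
proof -
  have 1: "set (take i xs @ drop k xs) \<subseteq> U" if "set xs \<subseteq> U" for i k xs
    using that set_take_subset[of i xs] set_drop_subset[of k xs] by auto
  have nth_face: "face (Delta U) n i xs ! k = xs ! (if k < i then k else Suc k)"
    and len_face: "length (face (Delta U) n i xs) = length xs - 1"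
    if "i < length xs" for n i k xs
    using that by (auto simp: Delta_def nth_append min_def)
  have nth_degen: "degen (Delta U) n j xs ! k = xs ! (if k \<le> j then k else k - 1)"
    if "j < length xs" "k \<le> length xs" for n j k xs
    using that by (auto simp: Delta_def nth_append min_def intro!: arg_cong[where f = "nth xs"])
  have len_degen: "length (degen (Delta U) n j xs) = Suc (length xs)"
    if "j < length xs" for n j xs
    using that by (auto simp: Delta_def)
  have len: "length xs = n + 1" if "xs \<in> simp (Delta U) n" for n xs
    using that by (simp add: Delta_def)
  note facts = nth_face len_face nth_degen len_degen len
  show ?thesis
    unfolding simplicial_set_def
  proof (intro conjI allI impI ballI)
    fix n i :: nat assume "i \<le> Suc n"
    then show "face (Delta U) (Suc n) i \<in> simp (Delta U) (Suc n) \<rightarrow> simp (Delta U) n"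
      using 1 by (auto simp: Delta_def simp del: set_append)
  next
    fix n j :: nat assume "j \<le> n"
    then show "degen (Delta U) n j \<in> simp (Delta U) n \<rightarrow> simp (Delta U) (Suc n)"
      using 1 by (auto simp: Delta_def simp del: set_append)
  qed (auto simp: facts intro!: nth_equalityI)
qed

lemma simplicial_set_Dist:
  assumes "simplicial_set Y"
  shows "simplicial_set (Dist Y)"
proof -
  note Y = assms[unfolded simplicial_set_def]
  have pi: "map_pmf f \<in> fin_dist A \<rightarrow> fin_dist B" if "f \<in> A \<rightarrow> B"
    for f :: "'a \<Rightarrow> 'a" and A B
    using that by (fastforce simp: fin_dist_def Pi_iff)
  have eq: "map_pmf f (map_pmf g p) = map_pmf h (map_pmf k p)"
    if "p \<in> fin_dist A" "\<And>x. x \<in> A \<Longrightarrow> f (g x) = h (k x)"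
    for f g h k :: "'a \<Rightarrow> 'a" and p A
    unfolding pmf.map_comp using that by (intro map_pmf_cong) (auto simp: fin_dist_def)
  have eq1: "map_pmf f (map_pmf g p) = p"
    if "p \<in> fin_dist A" "\<And>x. x \<in> A \<Longrightarrow> f (g x) = x"
    for f g :: "'a \<Rightarrow> 'a" and p A
    unfolding pmf.map_comp using that by (intro map_pmf_idI) (auto simp: fin_dist_def)
  show ?thesis
    unfolding simplicial_set_def Dist_def sset.simps
    by (intro conjI allI impI ballI; (rule pi | erule eq | erule eq1); use Y in simp)
qed

end

theory Submission
  imports Defs
begin

text \<open>
  A simplicial set map $X \to \Delta_{\mathbb{Z}_2}$ is the same as a labelling of the vertices by bits.
  Give a vertex its more likely outcome whenever its distribution is not uniform. On an edge, two
  outcomes of probability at least $1/2$ have joint probability zero only if both marginals are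
  uniform and the edge matrix is one of the two matrices of a PR box. So a labelling in the
  support exists as soon as the graph of those edges, signed by the type of their matrix, can be
  coloured with bits whose difference along each edge is its sign. An obstruction to
  the colouring is a cycle with odd total sign; a shortest one is a circle, and the
  distribution restricts to a PR box there. Conversely, the signs around a circle add up to zero for
  a labelling in the support.
\<close>

section \<open>Signed graphs\<close>

declare add_bit_eq_xor [simp del]

lemma bit_add_self [simp]: "a + a = (0 :: bit)" "a + (a + b) = (b :: bit)"
  by (cases a; cases b; simp)+

text \<open>A signed form of the theorem that a graph without odd cycles is bipartite: if no
  colouring exists, some closed walk has total sign 1, and a shortest one repeats neither vertices
  nor edges.\<close>

lemma unbalanced_cycle:
  fixes d :: "nat \<Rightarrow> 'e \<Rightarrow> 'v" and s :: "'e \<Rightarrow> bit"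
  assumes "\<nexists>c. \<forall>e\<in>E. c (d 1 e) + c (d 0 e) = s e"
  obtains n e v where "n \<ge> 1" "inj_on v {..<n}" "inj_on e {..<n}" "v n = v 0" "e ` {..<n} \<subseteq> E"
    "\<And>k. k < n \<Longrightarrow> \<exists>i\<in>{0, 1}. d i (e k) = v k \<and> d (1 - i) (e k) = v (Suc k)"
    "(\<Sum>k<n. s (e k)) = 1"
proof -
  \<comment> \<open>\<open>R\<close> is the double cover of the signed graph: a walk from \<open>(v, a)\<close> to \<open>(v, a + 1)\<close> is a
    closed walk with odd total sign.\<close>
  define R where "R = {((v, a), (w, b)) | v a w b.
    \<exists>e\<in>E. \<exists>i\<in>{0, 1}. d i e = v \<and> d (1 - i) e = w \<and> b = a + s e}"
  have R_edge: "((d i e, a), (d (1 - i) e, a + s e)) \<in> R" if "e \<in> E" "i \<in> {0, 1}" for e i a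
    using that unfolding R_def by blast
  have "sym R"
  proof (rule symI)
    fix x y assume "(x, y) \<in> R"
    then obtain e i a where "e \<in> E" "i \<in> {0, 1}" "x = (d i e, a)" "y = (d (1 - i) e, a + s e)"
      unfolding R_def by blast
    then show "(y, x) \<in> R"
      using R_edge[of e "1 - i" "a + s e"] by (auto simp: add.assoc)
  qed
  then have R_sym: "(y, x) \<in> R\<^sup>*" if "(x, y) \<in> R\<^sup>*" for x y
    using that sym_rtrancl symD by metis
  \<comment> \<open>Adding 1 to both bits is the deck transformation of the double cover, so a walk
    can be started over its first vertex with either bit.\<close>
  have flip1: "((v, a + 1), (w, b + 1)) \<in> R" if "((v, a), (w, b)) \<in> R" for v a w b
    using that unfolding R_def by (auto simp: ac_simps)
  have flip: "((v, a + 1), (w, b + 1)) \<in> R\<^sup>*" if "((v, a), (w, b)) \<in> R\<^sup>*" for v a w b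
    using that by (induction rule: rtrancl_induct2) (auto intro: rtrancl_into_rtrancl flip1 simp del: bit_not_zero_iff bit_not_one_iff)
  have neq: "b = a + 1" if "a \<noteq> b" for a b :: bit
    using that by (cases a; cases b) auto
  have start: "\<exists>b. ((v, a'), (w, b)) \<in> R\<^sup>*" if "((v, a), (w, b)) \<in> R\<^sup>*" for v a w b a'
    using that flip[OF that] neq[of a a'] by metis
  have "\<exists>v a. ((v, a), (v, a + 1)) \<in> R\<^sup>*"
  proof (rule ccontr)
    assume no: "\<nexists>v a. ((v, a), (v, a + 1)) \<in> R\<^sup>*"
    have unique: "a = b" if "(x, (v, a)) \<in> R\<^sup>*" "(x, (v, b)) \<in> R\<^sup>*" for x v a b
    proof (rule ccontr)
      assume "a \<noteq> b"
      then have "b = a + 1" by (rule neq)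
      then show False using no rtrancl_trans[OF R_sym[OF that(1)] that(2)] by auto
    qed
    \<comment> \<open>If no two lifts of a vertex are joined, a colouring exists: each component
      gets a root, chosen from the set \<open>comp v\<close> alone and hence shared by adjacent
      vertices, and \<open>c v\<close> is the only bit over \<open>v\<close> reached from the root
      with bit 0.\<close>
    define comp where "comp v = {w. \<exists>a b. ((v, a), (w, b)) \<in> R\<^sup>*}" for v
    define root where "root v = (SOME w. w \<in> comp v)" for v
    define c where "c v = (SOME b. ((root v, 0), (v, b)) \<in> R\<^sup>*)" for v
    have c: "((root v, 0), (v, c v)) \<in> R\<^sup>*" for v
    proof -
      have "v \<in> comp v" by (auto simp: comp_def)
      then have "root v \<in> comp v" unfolding root_def by (rule someI)
      then obtain a b where "((v, a), (root v, b)) \<in> R\<^sup>*" by (auto simp: comp_def)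
      then have ab: "((root v, b), (v, a)) \<in> R\<^sup>*" by (rule R_sym)
      have "\<exists>b. ((root v, 0), (v, b)) \<in> R\<^sup>*"
        using ab by (rule start)
      then show ?thesis unfolding c_def by (rule someI_ex)
    qed
    have comp_sub: "comp w \<subseteq> comp v" if vw: "((v, a), (w, b)) \<in> R\<^sup>*" for v a w b
    proof
      fix u assume "u \<in> comp w"
      then obtain a' b' where u: "((w, a'), (u, b')) \<in> R\<^sup>*" by (auto simp: comp_def)
      have "\<exists>b'. ((w, b), (u, b')) \<in> R\<^sup>*"
        using u by (rule start)
      then show "u \<in> comp v" using rtrancl_trans[OF vw] unfolding comp_def by blast
    qed
    have "c (d 1 e) + c (d 0 e) = s e" if "e \<in> E" for e
    proof -
      have step: "((d 1 e, c (d 1 e)), (d 0 e, c (d 1 e) + s e)) \<in> R\<^sup>*"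
        using R_edge[OF that, of 1] by auto
      have "comp (d 1 e) = comp (d 0 e)"
        using comp_sub[OF step] comp_sub[OF R_sym[OF step]] by blast
      then have "root (d 1 e) = root (d 0 e)" by (simp add: root_def)
      then have "c (d 0 e) = c (d 1 e) + s e"
        using unique c[of "d 0 e"] rtrancl_trans[OF c[of "d 1 e"] step] by metis
      then show ?thesis by (simp flip: add.assoc)
    qed
    then show False using assms by blast
  qed
  then obtain n0 where "\<exists>v a. ((v, a), (v, a + 1)) \<in> R ^^ n0"
    using rtrancl_imp_relpow by metis
  \<comment> \<open>The length is minimal over all vertices and starting bits.\<close>
  then obtain n where n: "\<exists>v a. ((v, a), (v, a + 1)) \<in> R ^^ n"
    and minimal: "\<And>m v a. m < n \<Longrightarrow> ((v, a), (v, a + 1)) \<notin> R ^^ m"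
    using exists_least_iff[of "\<lambda>n. \<exists>v a. ((v, a), (v, a + 1)) \<in> R ^^ n"] by metis
  then obtain v\<^sub>0 a\<^sub>0 f where f: "f 0 = (v\<^sub>0, a\<^sub>0)" "f n = (v\<^sub>0, a\<^sub>0 + 1)" "\<And>i. i < n \<Longrightarrow> (f i, f (Suc i)) \<in> R"
    unfolding relpow_fun_conv by blast
  have "n \<noteq> 0"
  proof
    assume "n = 0"
    then have "a\<^sub>0 = a\<^sub>0 + 1" using f(1,2) by simp
    then show False by (cases a\<^sub>0) auto
  qed
  have path: "(f i, f j) \<in> R ^^ (j - i)" if "i \<le> j" "j \<le> n" for i j
    unfolding relpow_fun_conv using that f(3) by (intro exI[of _ "\<lambda>k. f (i + k)"]) auto
  \<comment> \<open>If a vertex recurs with the same bit, the part in between can be cut out; if it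
    recurs with the other bit, that part is already an odd closed walk. Either way the result is
    shorter than \<open>n\<close>.\<close>
  have distinct: "i = 0 \<and> j = n" if "fst (f i) = fst (f j)" "i < j" "j \<le> n" for i j
  proof (rule ccontr)
    assume *: "\<not> (i = 0 \<and> j = n)"
    show False
    proof (cases "snd (f i) = snd (f j)")
      case True
      then have "f i = f j" using that by (simp add: prod_eq_iff)
      then have "(f 0, f n) \<in> R ^^ (i + (n - j))"
        using path[of 0 i] path[of j n] that unfolding relpow_add by auto
      moreover have "i + (n - j) < n" using that by auto
      ultimately show False using minimal f(1,2) by metis
    next
      case False
      then have "f j = (fst (f i), snd (f i) + 1)"
        using that neq by (simp add: prod_eq_iff)
      moreover have "(f i, f j) \<in> R ^^ (j - i)" "j - i < n" using path that * by auto
      ultimately show False using minimal by (metis prod.collapse)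
    qed
  qed
  define v where "v k = fst (f k)" for k
  have "\<exists>e. e \<in> E \<and> (\<exists>i\<in>{0, 1}. d i e = v k \<and> d (1 - i) e = v (Suc k)) \<and> snd (f (Suc k)) = snd (f k) + s e"
    if "k < n" for k
    using f(3)[OF that] unfolding R_def v_def by force
  then obtain e where e: "\<And>k. k < n \<Longrightarrow> e k \<in> E"
    "\<And>k. k < n \<Longrightarrow> \<exists>i\<in>{0, 1}. d i (e k) = v k \<and> d (1 - i) (e k) = v (Suc k)"
    "\<And>k. k < n \<Longrightarrow> snd (f (Suc k)) = snd (f k) + s (e k)"
    by metis
  have "snd (f k) = snd (f 0) + (\<Sum>j<k. s (e j))" if "k \<le> n" for k
    using that by (induction k) (auto simp: e(3) add.assoc)
  from this[of n] have sum: "(\<Sum>k<n. s (e k)) = 1" using f(1,2) by simp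
  have "inj_on v {..<n}"
  proof (intro linorder_inj_onI')
    fix i j assume "i \<in> {..<n}" "j \<in> {..<n}" "i < j"
    then show "v i \<noteq> v j" using distinct[of i j] by (auto simp: v_def)
  qed
  moreover have "inj_on e {..<n}"
  proof (intro linorder_inj_onI')
    fix j k assume jk: "j \<in> {..<n}" "k \<in> {..<n}" "j < k"
    show "e j \<noteq> e k"
    proof
      \<comment> \<open>The two traversals of the edge start at different vertices, so they run in
        opposite directions. Distinctness of the vertices then forces \<open>n = 2\<close>: the walk
        goes to and fro along one edge and the signs cancel.\<close>
      assume eq: "e j = e k"
      have "v j \<noteq> v k" using distinct[of j k] jk by (auto simp: v_def)
      then have "v j = v (Suc k)" "v (Suc j) = v k"
        using e(2)[of j] e(2)[of k] eq jk by auto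
      then have "j = 0" "Suc k = n" "Suc j = k"
        using distinct[of j "Suc k"] distinct[of "Suc j" k] jk
        by (auto simp: v_def) (metis Suc_lessI less_SucI nat.distinct(1) less_imp_le)
      then have "{..<n} = {j, k}" "j \<noteq> k" by auto
      then have "(\<Sum>k<n. s (e k)) = 0" using eq by simp
      then show False using sum by simp
    qed
  qed
  moreover have "v n = v 0" using f(1,2) by (simp add: v_def)
  ultimately show ?thesis using that[of n v e] \<open>n \<noteq> 0\<close> e(1,2) sum by force
qed

section \<open>Vertices and generated simplicial subsets\<close>

fun first_vertex :: "'a sset \<Rightarrow> nat \<Rightarrow> 'a \<Rightarrow> 'a" where
  "first_vertex X 0 x = x"
| "first_vertex X (Suc n) x = first_vertex X n (face X (Suc n) (Suc n) x)"

text \<open>The canonical map from \<open>X\<close> to \<open>Delta (simp X 0)\<close>: the initial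
  vertex is what remains after all last faces, and d_0 removes it.\<close>

fun vertices :: "'a sset \<Rightarrow> nat \<Rightarrow> 'a \<Rightarrow> 'a list" where
  "vertices X 0 x = [x]"
| "vertices X (Suc n) x = first_vertex X (Suc n) x # vertices X n (face X (Suc n) 0 x)"

context
  fixes X :: "'a sset"
  assumes X: "simplicial_set X"
begin

lemmas simplicial_identities = X[unfolded simplicial_set_def]

lemma face_in: "x \<in> simp X (Suc n) \<Longrightarrow> i \<le> Suc n \<Longrightarrow> face X (Suc n) i x \<in> simp X n"
  using simplicial_identities[THEN conjunct1] by blast

lemma degen_in: "x \<in> simp X n \<Longrightarrow> j \<le> n \<Longrightarrow> degen X n j x \<in> simp X (Suc n)"
  using simplicial_identities[THEN conjunct2, THEN conjunct1] by blast

lemma face_face: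
  assumes "x \<in> simp X (Suc (Suc n))" "i \<le> j" "j \<le> Suc n"
  shows "face X (Suc n) i (face X (Suc (Suc n)) (Suc j) x) = face X (Suc n) j (face X (Suc (Suc n)) i x)"
  using simplicial_identities[THEN conjunct2, THEN conjunct2, THEN conjunct1,
    rule_format, of x n i "Suc j"] assms by simp

lemma face_degen_less:
  assumes "x \<in> simp X (Suc n)" "i \<le> j" "j \<le> n"
  shows "face X (Suc (Suc n)) i (degen X (Suc n) (Suc j) x) = degen X n j (face X (Suc n) i x)"
  using simplicial_identities[THEN conjunct2, THEN conjunct2, THEN conjunct2, THEN conjunct2,
    THEN conjunct1, rule_format, of x n i "Suc j"] assms by simp

lemma face_degen_same:
  assumes "x \<in> simp X n" "j \<le> n"
  shows "face X (Suc n) j (degen X n j x) = x" "face X (Suc n) (Suc j) (degen X n j x) = x"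
  using simplicial_identities[THEN conjunct2, THEN conjunct2, THEN conjunct2, THEN conjunct2,
    THEN conjunct2, THEN conjunct1, rule_format, of x n j] assms by simp_all

lemma face_degen_greater:
  assumes "x \<in> simp X (Suc n)" "j < i" "i \<le> Suc n"
  shows "face X (Suc (Suc n)) (Suc i) (degen X (Suc n) j x) = degen X n j (face X (Suc n) i x)"
  using simplicial_identities[THEN conjunct2, THEN conjunct2, THEN conjunct2, THEN conjunct2,
    THEN conjunct2, THEN conjunct2, rule_format, of x n j "Suc i"] assms by simp

text \<open>For \<open>i < n\<close> the face commutes past the last face, on which the recursion of
  \<open>first_vertex\<close> runs; for \<open>i = n\<close> it is that last face.\<close>

lemma first_vertex_face:
  "x \<in> simp X (Suc n) \<Longrightarrow> i \<le> n \<Longrightarrow>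
    first_vertex X n (face X (Suc n) (Suc i) x) = first_vertex X (Suc n) x"
proof (induction n arbitrary: x)
  case (Suc n)
  show ?case
  proof (cases "i = Suc n")
    case False
    then have "first_vertex X (Suc n) (face X (Suc (Suc n)) (Suc i) x)
      = first_vertex X n (face X (Suc n) (Suc i) (face X (Suc (Suc n)) (Suc (Suc n)) x))"
      using Suc.prems by (simp add: face_face)
    also have "\<dots> = first_vertex X (Suc n) (face X (Suc (Suc n)) (Suc (Suc n)) x)"
      using Suc False by (intro Suc.IH face_in) auto
    finally show ?thesis by simp
  qed simp
qed simp

text \<open>Induction on the dimension: d_0 drops the head, while d_(j+1) keeps the head and acts on
  the tail as d_j, because d_0 d_(j+1) = d_j d_0.\<close>

lemma vertices_face:
  "x \<in> simp X (Suc n) \<Longrightarrow> i \<le> Suc n \<Longrightarrow>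
    vertices X n (face X (Suc n) i x) = take i (vertices X (Suc n) x) @ drop (Suc i) (vertices X (Suc n) x)"
proof (induction n arbitrary: x i)
  case 0
  then have "i = 0 \<or> i = Suc 0" by auto
  then show ?case by auto
next
  case (Suc n)
  show ?case
  proof (cases i)
    case (Suc j)
    then have "vertices X (Suc n) (face X (Suc (Suc n)) i x) =
      first_vertex X (Suc (Suc n)) x # vertices X n (face X (Suc n) j (face X (Suc (Suc n)) 0 x))"
      using Suc.prems by (simp add: first_vertex_face face_face del: first_vertex.simps)
    moreover have "vertices X (Suc (Suc n)) x =
      first_vertex X (Suc (Suc n)) x # vertices X (Suc n) (face X (Suc (Suc n)) 0 x)"
      by (rule vertices.simps)
    ultimately show ?thesis
      using Suc Suc.IH[OF face_in, of x 0 j] Suc.prems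
      by (simp del: first_vertex.simps vertices.simps)
  qed simp
qed

lemma vertices_degen:
  "x \<in> simp X n \<Longrightarrow> j \<le> n \<Longrightarrow>
    vertices X (Suc n) (degen X n j x) = take (Suc j) (vertices X n x) @ drop j (vertices X n x)"
proof (induction n arbitrary: x j)
  case 0
  then show ?case using face_degen_same[of x 0 0] by simp
next
  case (Suc n)
  \<comment> \<open>The face d_(j+1) preserves the initial vertex and undoes s_j.\<close>
  have first: "first_vertex X (Suc (Suc n)) (degen X (Suc n) j x) = first_vertex X (Suc n) x"
    using first_vertex_face[of "degen X (Suc n) j x" "Suc n" j] Suc.prems
    by (simp add: degen_in face_degen_same)
  show ?case
  proof (cases j)
    case 0
    then show ?thesis using first Suc.prems by (simp add: face_degen_same(1) del: first_vertex.simps)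
  next
    case (Suc i)
    then show ?thesis
      using first Suc.prems Suc.IH[OF face_in, of x 0 i]
      by (simp add: face_degen_less vertices.simps(2)[of X "Suc n"] vertices.simps(2)[of X n x]
          del: first_vertex.simps vertices.simps(2))
  qed
qed

text \<open>The canonical map into vertex lists, followed by the map that \<open>c\<close> induces:
  every vertex labelling extends to all dimensions.\<close>

lemma simplicial_map_vertices:
  "simplicial_map X (Delta UNIV) (\<lambda>n x. map c (vertices X n x))"
proof -
  have "length (vertices X n x) = Suc n" for n x
    by (induction n arbitrary: x) auto
  then show ?thesis
    unfolding simplicial_map_def
    by (auto simp: Delta_def vertices_face vertices_degen take_map drop_map
        simp del: vertices.simps)
qed

end

text \<open>No closure under faces is needed: the simplicial identities provide it.\<close>

inductive_set gen_simp :: "'a sset \<Rightarrow> 'a set \<Rightarrow> (nat \<times> 'a) set" for X E where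
  vertex: "e \<in> E \<Longrightarrow> i \<le> 1 \<Longrightarrow> (0, face X 1 i e) \<in> gen_simp X E"
| edge: "e \<in> E \<Longrightarrow> (1, e) \<in> gen_simp X E"
| degen: "(n, x) \<in> gen_simp X E \<Longrightarrow> j \<le> n \<Longrightarrow> (Suc n, degen X n j x) \<in> gen_simp X E"

definition gen_sset :: "'a sset \<Rightarrow> 'a set \<Rightarrow> 'a sset" where
  "gen_sset X E = X\<lparr>simp := \<lambda>n. {x. (n, x) \<in> gen_simp X E}\<rparr>"

section \<open>Structure of the generated simplicial subset\<close>

context
  fixes X :: "'a sset" and E :: "'a set"
  assumes X: "simplicial_set X" and E: "E \<subseteq> nondegenerate X 1"
begin

lemma gen_simp_subset: "(n, x) \<in> gen_simp X E \<Longrightarrow> x \<in> simp X n"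
proof (induction n x rule: gen_simp.induct)
  case (vertex e i)
  then show ?case using face_in[OF X, of e 0 i] E by (auto simp: nondegenerate_def)
next
  case (edge e)
  then show ?case using E by (auto simp: nondegenerate_def)
next
  case (degen n x j)
  then show ?case using degen_in[OF X] by auto
qed

text \<open>A face of s_j x is either x itself or a degeneracy of a face of x, and the induction
  hypothesis covers the latter.\<close>

lemma gen_simp_face:
  "(n, x) \<in> gen_simp X E \<Longrightarrow> n = Suc m \<Longrightarrow> i \<le> n \<Longrightarrow> (m, face X n i x) \<in> gen_simp X E"
proof (induction n x arbitrary: m i rule: gen_simp.induct)
  case (degen n x j)
  have x: "x \<in> simp X n" using gen_simp_subset degen by blast
  consider "i = j \<or> i = Suc j" | "i < j" | "Suc j < i" by linarith
  then show ?case
  proof cases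
    case 1
    then show ?thesis using degen x face_degen_same[OF X x] by auto
  next
    case 2
    then obtain j' where j': "j = Suc j'" by (cases j) auto
    then obtain n' where n': "n = Suc n'" using degen by (cases n) auto
    show ?thesis using 2 degen x j' n' by (auto simp: face_degen_less[OF X] intro!: gen_simp.degen)
  next
    case 3
    then obtain i' where i': "i = Suc i'" by (cases i) auto
    then obtain n' where n': "n = Suc n'" using 3 degen by (cases n) auto
    show ?thesis using 3 degen x i' n' by (auto simp: face_degen_greater[OF X] intro!: gen_simp.degen)
  qed
qed (auto intro: gen_simp.vertex[simplified])

lemma simplicial_subset_gen_sset: "simplicial_subset (gen_sset X E) X"
proof -
  have sub: "simp (gen_sset X E) n \<subseteq> simp X n"
    and face: "face (gen_sset X E) = face X"
    and degen: "degen (gen_sset X E) = degen X" for n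
    using gen_simp_subset by (auto simp: gen_sset_def)
  have face_in: "face X (Suc n) i \<in> simp (gen_sset X E) (Suc n) \<rightarrow> simp (gen_sset X E) n"
    if "i \<le> Suc n" for n i
    using that gen_simp_face[OF _ refl] by (simp add: gen_sset_def)
  have degen_in: "degen X n j \<in> simp (gen_sset X E) n \<rightarrow> simp (gen_sset X E) (Suc n)"
    if "j \<le> n" for n j
    using that by (auto simp: gen_sset_def intro: gen_simp.degen)
  have "simplicial_set (gen_sset X E)"
    unfolding simplicial_set_def face degen
  proof (intro conjI)
    show "\<forall>n. \<forall>i\<le>Suc n. face X (Suc n) i \<in> simp (gen_sset X E) (Suc n) \<rightarrow> simp (gen_sset X E) n"
      using face_in by blast
    show "\<forall>n. \<forall>j\<le>n. degen X n j \<in> simp (gen_sset X E) n \<rightarrow> simp (gen_sset X E) (Suc n)"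
      using degen_in by blast
  \<comment> \<open>What remains are the simplicial identities of \<open>X\<close>, restricted to
    fewer simplices.\<close>
  qed (use X[unfolded simplicial_set_def] sub in \<open>meson subsetD\<close>)+
  then show ?thesis
    unfolding simplicial_subset_def face degen using sub by blast
qed

text \<open>The rule \<open>degen\<close> yields only degenerate simplices. Edges in
  \<open>E\<close> stay non-degenerate, since a degeneracy inside the subset is also one in
  \<open>X\<close>.\<close>

lemma nondegenerate_gen_sset:
  "nondegenerate (gen_sset X E) n =
     (if n = 0 then {face X 1 i e | e i. e \<in> E \<and> i \<le> 1} else if n = 1 then E else {})"
proof -
  have "x \<in> nondegenerate (gen_sset X E) n \<longleftrightarrow>
      (n = 0 \<and> (\<exists>e i. x = face X 1 i e \<and> e \<in> E \<and> i \<le> 1)) \<or> (n = 1 \<and> x \<in> E)" for x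
  proof
    assume x: "x \<in> nondegenerate (gen_sset X E) n"
    then have "(n, x) \<in> gen_simp X E" by (auto simp: nondegenerate_def gen_sset_def)
    then show "(n = 0 \<and> (\<exists>e i. x = face X 1 i e \<and> e \<in> E \<and> i \<le> 1)) \<or> (n = 1 \<and> x \<in> E)"
    proof cases
      case (degen m y j)
      then show ?thesis using x by (auto simp: nondegenerate_def gen_sset_def)
    qed auto
  next
    assume "(n = 0 \<and> (\<exists>e i. x = face X 1 i e \<and> e \<in> E \<and> i \<le> 1)) \<or> (n = 1 \<and> x \<in> E)"
    then show "x \<in> nondegenerate (gen_sset X E) n"
    proof
      assume x: "n = 1 \<and> x \<in> E"
      then have "x \<in> nondegenerate X 1" using E by auto
      then show ?thesis using x gen_simp_subset gen_simp.edge[of x E X]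
        by (fastforce simp: nondegenerate_def gen_sset_def)
    qed (auto simp: nondegenerate_def gen_sset_def intro: gen_simp.vertex[simplified])
  qed
  then show ?thesis by (intro set_eqI) auto
qed

end

lemma simplicial_map_subset:
  "simplicial_map X Y f \<Longrightarrow> simplicial_subset C X \<Longrightarrow> simplicial_map C Y f"
  unfolding simplicial_map_def simplicial_subset_def by (auto simp: Pi_iff subset_iff)

section \<open>Distributions on edges\<close>

lemma of_nat_bit_eq_1_iff: "of_nat n = (1 :: bit) \<longleftrightarrow> odd n"
  by (induction n) (auto simp del: bit_not_zero_iff)

text \<open>Faces are marginals: d_1 deletes the second outcome and d_0 the first. Hence the end
  given by \<open>face X 1 1\<close> comes first in every pair of outcomes below.\<close>

lemma edge_pmf:
  fixes q :: "bit list pmf"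
  assumes "set_pmf q \<subseteq> simp Delta_Z2 1"
  shows edge_pmf_face_1: "pmf (map_pmf (face Delta_Z2 1 1) q) [a] = pmf q [a, 0] + pmf q [a, 1]"
    and edge_pmf_face_0: "pmf (map_pmf (face Delta_Z2 1 0) q) [a] = pmf q [0, a] + pmf q [1, a]"
    and edge_pmf_sum: "pmf q [0, 0] + pmf q [0, 1] + pmf q [1, 0] + pmf q [1, 1] = 1"
proof -
  have UNIV_bit: "b = 0 \<or> b = 1" for b :: bit by (cases b) auto
  have L: "simp Delta_Z2 1 = {[0, 0], [0, 1], [1, 0], [1, 1]}"
    using UNIV_bit by (force simp: Delta_def length_Suc_conv numeral_2_eq_2)
  \<comment> \<open>All mass lies on the four pairs, so preimages among arbitrary bit lists can be
    cut down to them.\<close>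
  have q: "measure q A = (\<Sum>x\<in>B. pmf q x)" if "A \<inter> simp Delta_Z2 1 = B" "finite B" for A B
  proof -
    have "measure q A = measure q (A \<inter> set_pmf q)" by (simp add: measure_Int_set_pmf)
    also have "A \<inter> set_pmf q = B \<inter> set_pmf q" using assms that(1) by blast
    also have "measure q (B \<inter> set_pmf q) = measure q B" by (simp add: measure_Int_set_pmf)
    finally show ?thesis using that(2) by (simp add: measure_measure_pmf_finite)
  qed
  have "face Delta_Z2 1 1 -` {[a]} \<inter> simp Delta_Z2 1 = {[a, 0], [a, 1]}"
    unfolding L using UNIV_bit[of a] by (auto simp: Delta_def)
  then show "pmf (map_pmf (face Delta_Z2 1 1) q) [a] = pmf q [a, 0] + pmf q [a, 1]"
    by (simp add: pmf_map q)
  have "face Delta_Z2 1 0 -` {[a]} \<inter> simp Delta_Z2 1 = {[0, a], [1, a]}"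
    unfolding L using UNIV_bit[of a] by (auto simp: Delta_def)
  then show "pmf (map_pmf (face Delta_Z2 1 0) q) [a] = pmf q [0, a] + pmf q [1, a]"
    by (simp add: pmf_map q)
  show "pmf q [0, 0] + pmf q [0, 1] + pmf q [1, 0] + pmf q [1, 1] = 1"
    using sum_pmf_eq_1[of "simp Delta_Z2 1" q] assms unfolding L by (simp add: add.assoc)
qed

section \<open>Edge matrices and majority outcomes\<close>

abbreviation correlated :: "(real \<times> real) \<times> (real \<times> real)" where
  "correlated \<equiv> ((1/2, 0), (0, 1/2))"

abbreviation anticorrelated :: "(real \<times> real) \<times> (real \<times> real)" where
  "anticorrelated \<equiv> ((0, 1/2), (1/2, 0))"

text \<open>The bit \<open>b\<close> only breaks ties; this is the freedom left to a colouring at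
  vertices with uniform distribution.\<close>

definition majority :: "bit list pmf \<Rightarrow> bit \<Rightarrow> bit" where
  "majority r b = (if pmf r [0] > 1/2 then 0 else if pmf r [0] < 1/2 then 1 else b)"

text \<open>The chosen outcome has probability at least 1/2.\<close>

lemma majority_pmf_neq_0:
  assumes "set_pmf r \<subseteq> simp Delta_Z2 0"
  shows "pmf r [majority r b] \<noteq> 0"
proof -
  have "simp Delta_Z2 0 = {[0], [1]}"
    by (auto simp: Delta_def length_Suc_conv)
  then have "pmf r [0] + pmf r [1] = 1"
    using sum_pmf_eq_1[of "simp Delta_Z2 0" r] assms by simp
  then show ?thesis by (cases b) (auto simp: majority_def)
qed

text \<open>Outcomes that both have probability at least $1/2$ can be jointly impossible only if they
  both have probability exactly $1/2$.\<close>

lemma majority_pmf_eq_0: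
  fixes q :: "bit list pmf"
  assumes "set_pmf q \<subseteq> simp Delta_Z2 1"
    and zero: "pmf q [majority (map_pmf (face Delta_Z2 1 1) q) a, majority (map_pmf (face Delta_Z2 1 0) q) b] = 0"
  shows "edge_matrix q = correlated \<and> a + b = 1 \<or> edge_matrix q = anticorrelated \<and> a + b = 0"
proof -
  note q = edge_pmf[OF assms(1)]
  have nonneg: "pmf q [0, 0] \<ge> 0" "pmf q [0, 1] \<ge> 0" "pmf q [1, 0] \<ge> 0" "pmf q [1, 1] \<ge> 0"
    by simp_all
  \<comment> \<open>With the four entries as opaque reals, each case of \<open>a\<close>,
    \<open>b\<close> and the two marginals is linear arithmetic.\<close>
  obtain Q where "pmf q = Q" by blast
  then show ?thesis
    using zero q(3) nonneg unfolding majority_def q(1,2) edge_matrix_def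
    by (cases a; cases b; simp only:) (auto split: if_splits)
qed

text \<open>For a map in the support, the bits at the ends of an edge differ exactly if its matrix
  is anticorrelated. Around the circle the differences telescope to 0, whereas an odd number of
  anticorrelated edges makes their sum 1.\<close>

lemma supp_PR_box:
  assumes "PR_box C p"
  shows "supp C Delta_Z2 p = {}"
proof (rule ccontr)
  assume "supp C Delta_Z2 p \<noteq> {}"
  then obtain \<phi> where \<phi>: "simplicial_map C Delta_Z2 \<phi>"
    and nz: "\<And>n x. x \<in> simp C n \<Longrightarrow> pmf (p n x) (\<phi> n x) \<noteq> 0"
    by (auto simp: supp_def)
  obtain n \<sigma> v where C: "circle_data C n \<sigma> v"
    and matrix: "\<forall>k\<in>{1..n}. edge_matrix (p 1 (\<sigma> k)) = correlated \<or> edge_matrix (p 1 (\<sigma> k)) = anticorrelated"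
    and odd: "odd (card {k\<in>{1..n}. edge_matrix (p 1 (\<sigma> k)) = anticorrelated})"
    using assms by (auto simp: PR_box_def)
  define a where "a x = hd (\<phi> 0 x)" for x
  have diff: "a (v (Suc k)) - a (v k) = of_bool (edge_matrix (p 1 (\<sigma> k)) = anticorrelated)"
    if k: "k \<in> {1..n}" for k
  proof -
    have "\<sigma> k \<in> nondegenerate C 1" using C k by (auto simp: circle_data_def bij_betw_def)
    then have \<sigma>: "\<sigma> k \<in> simp C 1" by (simp add: nondegenerate_def)
    then have "\<phi> 1 (\<sigma> k) \<in> simp Delta_Z2 1" using \<phi> unfolding simplicial_map_def by blast
    then obtain b b' where b: "\<phi> 1 (\<sigma> k) = [b, b']"
      by (auto simp: Delta_def length_Suc_conv numeral_2_eq_2)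
    have "\<phi> 0 (face C 1 i (\<sigma> k)) = face Delta_Z2 1 i [b, b']" if "i \<le> 1" for i
      using \<phi> \<sigma> that b unfolding simplicial_map_def by (metis One_nat_def)
    from this[of 0] this[of 1] have faces: "a (face C 1 0 (\<sigma> k)) = b'" "a (face C 1 1 (\<sigma> k)) = b"
      by (simp_all add: a_def Delta_def)
    have "pmf (p 1 (\<sigma> k)) [b, b'] \<noteq> 0" using nz[OF \<sigma>] b by simp
    \<comment> \<open>Both orders are recorded because the circle may traverse the edge from either
      end.\<close>
    then have b_diff: "b' - b = of_bool (edge_matrix (p 1 (\<sigma> k)) = anticorrelated)"
      "b - b' = of_bool (edge_matrix (p 1 (\<sigma> k)) = anticorrelated)"
      using matrix k by (cases b; cases b'; auto simp: edge_matrix_def)+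
    have "\<exists>i\<in>{0, 1}. face C 1 i (\<sigma> k) = v k \<and> face C 1 (1 - i) (\<sigma> k) = v (k + 1)"
      using C k unfolding circle_data_def by blast
    then show ?thesis using faces b_diff by auto
  qed
  have "(\<Sum>k=1..n. of_bool (edge_matrix (p 1 (\<sigma> k)) = anticorrelated)) =
      (\<Sum>k=1..n. a (v (Suc k)) - a (v k))"
    by (intro sum.cong refl) (simp only: diff)
  also have "\<dots> = a (v (Suc n)) - a (v 1)"
    by (rule sum_Suc_diff) simp
  also have "\<dots> = 0" using C by (simp add: circle_data_def)
  finally have "(\<Sum>k=1..n. of_bool (edge_matrix (p 1 (\<sigma> k)) = anticorrelated)) = (0 :: bit)" .
  moreover have "(\<Sum>k=1..n. of_bool (edge_matrix (p 1 (\<sigma> k)) = anticorrelated)) = (1 :: bit)"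
    using odd by (simp add: sum_of_bool_eq of_nat_bit_eq_1_iff Int_def)
  ultimately show False by simp
qed

section \<open>Vertex colourings in the support, and circles from closed walks\<close>

lemma supp_subset:
  assumes "simplicial_subset C X"
  shows "supp X Y p \<subseteq> supp C Y p"
proof -
  have "simp C n \<subseteq> simp X n" for n using assms by (simp add: simplicial_subset_def)
  then show ?thesis using simplicial_map_subset[OF _ assms] unfolding supp_def by blast
qed

text \<open>Degeneracies carry possible outcomes to possible outcomes, so induction on the dimension
  reduces the support condition to non-degenerate simplices; in a 1-skeletal set these are vertices
  and edges.\<close>

lemma vertex_coloring_in_supp:
  assumes X: "simplicial_set X" "skeletal 1 X"
    and p: "simplicial_distribution X Delta_Z2 p"
    and vertex: "\<And>x. x \<in> simp X 0 \<Longrightarrow> pmf (p 0 x) [c x] \<noteq> 0"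
    and edge: "\<And>x. x \<in> nondegenerate X 1 \<Longrightarrow> pmf (p 1 x) [c (face X 1 1 x), c (face X 1 0 x)] \<noteq> 0"
  shows "(\<lambda>n x. map c (vertices X n x)) \<in> supp X Delta_Z2 p"
proof -
  have "pmf (p n x) (map c (vertices X n x)) \<noteq> 0" if "x \<in> simp X n" for n x
    using that
  proof (induction n arbitrary: x)
    case 0
    then show ?case using vertex by simp
  next
    case (Suc n)
    show ?case
    proof (cases "x \<in> nondegenerate X (Suc n)")
      case True
      then have "n = 0" using X(2) unfolding skeletal_def by force
      then show ?thesis using edge True by simp
    next
      case False
      then obtain j y where y: "j \<le> n" "y \<in> simp X n" "x = degen X n j y"
        using Suc.prems by (auto simp: nondegenerate_def)
      \<comment> \<open>As a statement about \<open>set_pmf\<close>, the claim passes along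
        \<open>map_pmf\<close> by taking images.\<close>
      have "map c (vertices X n y) \<in> set_pmf (p n y)" using Suc.IH[OF y(2)] by (simp add: set_pmf_iff)
      moreover have "p (Suc n) x = map_pmf (degen Delta_Z2 n j) (p n y)"
        using p y by (simp add: simplicial_distribution_def simplicial_map_def Dist_def)
      moreover have "map c (vertices X (Suc n) x) = degen Delta_Z2 n j (map c (vertices X n y))"
        using vertices_degen[OF X(1) y(2,1)] y(3)
        by (simp add: Delta_def take_map drop_map del: vertices.simps)
      ultimately show ?thesis by (simp add: set_pmf_iff[symmetric] del: vertices.simps)
    qed
  qed
  then show ?thesis using simplicial_map_vertices[OF X(1)] by (simp add: supp_def)
qed

text \<open>The walk is indexed from 0 and the circle from 1, so \<open>v n = v 0\<close> becomes
  the closing condition of the circle.\<close>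

lemma circle_data_gen_sset:
  assumes X: "simplicial_set X" and n: "n \<ge> 1"
    and v: "inj_on v {..<n}" "v n = v 0"
    and e: "inj_on e {..<n}" "e ` {..<n} \<subseteq> nondegenerate X 1"
    and ends: "\<And>k. k < n \<Longrightarrow> \<exists>i\<in>{0, 1}. face X 1 i (e k) = v k \<and> face X 1 (1 - i) (e k) = v (Suc k)"
  shows "circle_data (gen_sset X (e ` {..<n})) n (\<lambda>k. e (k - 1)) (\<lambda>k. v (k - 1))"
proof -
  let ?C = "gen_sset X (e ` {..<n})"
  note nondeg = nondegenerate_gen_sset[OF X e(2)]
  have shift: "bij_betw (\<lambda>k. k - 1) {1..n} {..<n}"
    by (rule bij_betwI[where g = Suc]) auto
  have "simp ?C 0 = nondegenerate ?C 0" by (auto simp: nondegenerate_def)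
  also have "\<dots> = v ` {..<n}"
  proof -
    \<comment> \<open>The far end of the last edge is \<open>v n\<close>, which equals
      \<open>v 0\<close>.\<close>
    have wrap: "v k \<in> v ` {..<n}" if "k \<le> n" for k
      using that v(2) n by (cases "k = n") auto
    have "face X 1 i (e k) \<in> v ` {..<n}" if "k < n" "i \<le> 1" for i k
    proof -
      have "face X 1 i (e k) = v k \<or> face X 1 i (e k) = v (Suc k)"
        using ends[OF that(1)] that(2) by (auto simp: le_Suc_eq)
      then show ?thesis using wrap[of k] wrap[of "Suc k"] that(1) by auto
    qed
    moreover have "\<exists>i\<le>1. v k = face X 1 i (e k)" if "k < n" for k
      using ends[OF that] by force
    ultimately show ?thesis unfolding nondeg by fastforce
  qed
  finally have "bij_betw (\<lambda>k. v (k - 1)) {1..n} (simp ?C 0)"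
    using bij_betw_trans[OF shift inj_on_imp_bij_betw[OF v(1)]] by (simp add: comp_def)
  moreover have "bij_betw (\<lambda>k. e (k - 1)) {1..n} (nondegenerate ?C 1)"
    using bij_betw_trans[OF shift inj_on_imp_bij_betw[OF e(1)]] by (simp add: comp_def nondeg)
  moreover have "\<exists>i\<in>{0, 1}. face ?C 1 i (e (k - 1)) = v (k - 1) \<and> face ?C 1 (1 - i) (e (k - 1)) = v (k + 1 - 1)"
    if "k \<in> {1..n}" for k
  proof -
    have "k - 1 < n" "Suc (k - 1) = k" using that by auto
    then show ?thesis using ends[of "k - 1"] by (simp add: gen_sset_def)
  qed
  moreover have "skeletal 1 ?C" by (simp add: skeletal_def nondeg)
  moreover have "simplicial_set ?C"
    using simplicial_subset_gen_sset[OF X e(2)] by (simp add: simplicial_subset_def)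
  ultimately show ?thesis using n v(2) by (simp add: circle_data_def)
qed

theorem theorem4p30:
  fixes X :: "'a sset" and p :: "nat \<Rightarrow> 'a \<Rightarrow> bit list pmf"
  assumes "simplicial_set X"
    and "skeletal 1 X"
    and "finitely_many_nondegenerate X"
    and "simplicial_distribution X Delta_Z2 p"
  shows "strongly_contextual X Delta_Z2 p \<longleftrightarrow>
    (\<exists>C. circle C \<and> simplicial_subset C X \<and> PR_box C p)"
proof
  assume "\<exists>C. circle C \<and> simplicial_subset C X \<and> PR_box C p"
  then show "strongly_contextual X Delta_Z2 p"
    using supp_subset supp_PR_box unfolding strongly_contextual_def by blast
next
  assume contextual: "strongly_contextual X Delta_Z2 p"
  \<comment> \<open>These are the only edges at which two majority outcomes can be jointly
    impossible.\<close>
  define E where "E = {x \<in> nondegenerate X 1. edge_matrix (p 1 x) \<in> {correlated, anticorrelated}}"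
  define s :: "'a \<Rightarrow> bit" where "s x = of_bool (edge_matrix (p 1 x) = anticorrelated)" for x
  have "\<nexists>c. \<forall>x\<in>E. c (face X 1 1 x) + c (face X 1 0 x) = s x"
  proof
    assume "\<exists>c. \<forall>x\<in>E. c (face X 1 1 x) + c (face X 1 0 x) = s x"
    then obtain c where c: "\<And>x. x \<in> E \<Longrightarrow> c (face X 1 1 x) + c (face X 1 0 x) = s x" by blast
    define c' where "c' x = majority (p 0 x) (c x)" for x
    have set_pmf_p: "set_pmf (p n x) \<subseteq> simp Delta_Z2 n" if "x \<in> simp X n" for n x
      using assms(4) that unfolding simplicial_distribution_def simplicial_map_def
      by (auto simp: Dist_def fin_dist_def)
    have edge: "pmf (p 1 x) [c' (face X 1 1 x), c' (face X 1 0 x)] \<noteq> 0"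
      if "x \<in> nondegenerate X 1" for x
    proof
      assume zero: "pmf (p 1 x) [c' (face X 1 1 x), c' (face X 1 0 x)] = 0"
      have x: "x \<in> simp X 1" using that by (simp add: nondegenerate_def)
      have "p 0 (face X 1 i x) = map_pmf (face Delta_Z2 1 i) (p 1 x)" if "i \<le> 1" for i
        using assms(4) that x
        by (simp add: simplicial_distribution_def simplicial_map_def Dist_def)
      then have "edge_matrix (p 1 x) = correlated \<and> c (face X 1 1 x) + c (face X 1 0 x) = 1 \<or>
        edge_matrix (p 1 x) = anticorrelated \<and> c (face X 1 1 x) + c (face X 1 0 x) = 0"
        using majority_pmf_eq_0[OF set_pmf_p[OF x]] zero by (simp add: c'_def)
      \<comment> \<open>So \<open>x\<close> lies in \<open>E\<close>, but its end colours add up to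
        the opposite of \<open>s x\<close>.\<close>
      then show False using c[of x] that by (auto simp: E_def s_def)
    qed
    have vertex: "pmf (p 0 x) [c' x] \<noteq> 0" if "x \<in> simp X 0" for x
      unfolding c'_def by (rule majority_pmf_neq_0[OF set_pmf_p[OF that]])
    show False
      using vertex_coloring_in_supp[OF assms(1,2,4), of c'] vertex edge contextual
      by (auto simp: strongly_contextual_def nondegenerate_def)
  qed
  then obtain n e v where n: "n \<ge> 1" and v: "inj_on v {..<n}" and e: "inj_on e {..<n}"
    and closed: "v n = v 0" and E: "e ` {..<n} \<subseteq> E"
    and ends: "\<And>k. k < n \<Longrightarrow> \<exists>i\<in>{0, 1}. face X 1 i (e k) = v k \<and> face X 1 (1 - i) (e k) = v (Suc k)"
    and sum: "(\<Sum>k<n. s (e k)) = 1"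
    by (rule unbalanced_cycle) (use that in blast)
  define C where "C = gen_sset X (e ` {..<n})"
  have nondeg: "e ` {..<n} \<subseteq> nondegenerate X 1" using E by (auto simp: E_def)
  then have sub: "simplicial_subset C X" unfolding C_def by (rule simplicial_subset_gen_sset[OF assms(1)])
  have C: "circle_data C n (\<lambda>k. e (k - 1)) (\<lambda>k. v (k - 1))"
    unfolding C_def using circle_data_gen_sset[OF assms(1) n v closed e nondeg ends] by blast
  have "PR_box C p"
    unfolding PR_box_def
  proof (intro conjI exI)
    show "simplicial_distribution C Delta_Z2 p"
      using assms(4) simplicial_map_subset sub unfolding simplicial_distribution_def by blast
    show "\<forall>k\<in>{1..n}. edge_matrix (p 1 (e (k - 1))) = correlated \<or> edge_matrix (p 1 (e (k - 1))) = anticorrelated"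
    proof
      fix k assume "k \<in> {1..n}"
      then have "e (k - 1) \<in> E" using E by auto
      then show "edge_matrix (p 1 (e (k - 1))) = correlated \<or> edge_matrix (p 1 (e (k - 1))) = anticorrelated"
        by (simp add: E_def)
    qed
    \<comment> \<open>In \<open>bit\<close>, the total sign is the parity of the number of
      anticorrelated edges.\<close>
    have "(\<Sum>k=1..n. s (e (k - 1))) = 1"
      using sum by (simp add: sum.atLeast1_atMost_eq)
    then show "odd (card {k \<in> {1..n}. edge_matrix (p 1 (e (k - 1))) = anticorrelated})"
      by (simp add: s_def sum_of_bool_eq of_nat_bit_eq_1_iff Int_def)
  qed (rule C)
  then show "\<exists>C. circle C \<and> simplicial_subset C X \<and> PR_box C p"
    using C sub by (auto simp: circle_def)
qed

end
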